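(* The sequential algorithm with the early delivery scheduling policy is $\omega(1)$-approximate for the container delivery scheduling problem; that is, its approximation ratio is not bounded by any constant: for every constant $c$ there is an instance $\langle\mathcal{I},B\rangle$ on which the number of bins used by the algorithm is more than $c$ times the number of bins of an optimal solution.
   Context: An instance $\langle \mathcal{I},B\rangle$ of the container delivery scheduling problem consists of a set $\mathcal{I}=\{1,\ldots,n\}$ of items, each item $i$ having a due time $d_i\in\mathbb{Z}^+$, and an inventory bound $B>0$. For a time $\tau\ge 0$ put $\delta_i(\tau)=|d_i-\tau|$. A feasible solution with $m$ bins is a partition of $\mathcal{I}$ into subsets (bins) $\mathcal{S}_1,\ldots,\mathcal{S}_m$ together with delivery times $\mu_1,\ldots,\mu_m\ge 0$ such that $\sum_{i\in\mathcal{S}_j}\delta_i(\mu_j)\le B$ for every $j$. An optimal solution is a feasible solution minimizing $m$. Sequential algorithm: number the items so that $d_1\le\ldots\le d_n$. Open an empty bin $j=1$. For $i=1,\ldots,n$ in this order: if the inventory cost of the set $\mathcal{S}_j\cup\{i\}$, when delivered in one bin at the time prescribed by the scheduling policy, exceeds $B$, then open a new empty bin and let $j$ be its index ($j\leftarrow j+1$); in either case, add $i$ to $\mathcal{S}_j$. At the end each bin is delivered at the time prescribed by the policy. Early delivery scheduling policy: a set $\mathcal{S}_j$ of items packed in one bin is delivered at $\mu_j=\min_{i\in\mathcal{S}_j}d_i$, so its inventory cost is $\sum_{i\in\mathcal{S}_j}(d_i-\mu_j)$. *)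

theory Defs
  imports Complex_Main "HOL-Library.Disjoint_Sets"
begin

text \<open>
  An instance is given by the number n of items, their due times d and the inventory bound B.
  The items are the numbers 1, ..., n; values of d outside this range are irrelevant.
  Instances have at least one item: on an empty instance the algorithm would still hold one
  (empty) bin, whereas the optimum would be zero.
\<close>

definition cds_instance :: "nat \<Rightarrow> (nat \<Rightarrow> nat) \<Rightarrow> real \<Rightarrow> bool" where
  "cds_instance n d B \<longleftrightarrow> n \<ge> 1 \<and> (\<forall>i\<in>{1..n}. d i > 0) \<and> B > 0"

definition inventory_cost :: "(nat \<Rightarrow> nat) \<Rightarrow> nat set \<Rightarrow> real \<Rightarrow> real" where
  "inventory_cost d S \<tau> = (\<Sum>i\<in>S. \<bar>real (d i) - \<tau>\<bar>)"

definition feasible_solution ::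
  "nat \<Rightarrow> (nat \<Rightarrow> nat) \<Rightarrow> real \<Rightarrow> nat \<Rightarrow> (nat \<Rightarrow> nat set) \<Rightarrow> (nat \<Rightarrow> real) \<Rightarrow> bool" where
  "feasible_solution n d B m S \<mu> \<longleftrightarrow>
     partition_on {1..n} (S ` {1..m}) \<and> inj_on S {1..m} \<and>
     (\<forall>j\<in>{1..m}. \<mu> j \<ge> 0 \<and> inventory_cost d (S j) (\<mu> j) \<le> B)"

definition optimal_solution ::
  "nat \<Rightarrow> (nat \<Rightarrow> nat) \<Rightarrow> real \<Rightarrow> nat \<Rightarrow> (nat \<Rightarrow> nat set) \<Rightarrow> (nat \<Rightarrow> real) \<Rightarrow> bool" where
  "optimal_solution n d B m S \<mu> \<longleftrightarrow>
     feasible_solution n d B m S \<mu> \<and>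
     (\<forall>m' S' \<mu>'. feasible_solution n d B m' S' \<mu>' \<longrightarrow> m \<le> m')"

text \<open>A scheduling policy maps the due times and the content of a bin to a delivery time.\<close>

type_synonym policy = "(nat \<Rightarrow> nat) \<Rightarrow> nat set \<Rightarrow> real"

definition early_delivery :: policy where
  "early_delivery d S = real (Min (d ` S))"

text \<open>
  The state of the algorithm is the index j of the currently open bin together with the
  contents of all bins; bins that have not been opened yet are empty.
\<close>

definition sequential_step ::
  "policy \<Rightarrow> (nat \<Rightarrow> nat) \<Rightarrow> real \<Rightarrow> nat \<Rightarrow> nat \<times> (nat \<Rightarrow> nat set) \<Rightarrow> nat \<times> (nat \<Rightarrow> nat set)" where
  "sequential_step pol d B i = (\<lambda>(j, S).
     let T = insert i (S j);
         j' = (if inventory_cost d T (pol d T) > B then j + 1 else j)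
     in (j', S(j' := insert i (S j'))))"

text \<open>
  The items are processed in the order of non-decreasing due times, ties being broken by the
  item number. The result consists of the number of bins, their contents and delivery times.
\<close>

definition sequential_algorithm ::
  "policy \<Rightarrow> nat \<Rightarrow> (nat \<Rightarrow> nat) \<Rightarrow> real \<Rightarrow> nat \<times> (nat \<Rightarrow> nat set) \<times> (nat \<Rightarrow> real)" where
  "sequential_algorithm pol n d B =
     (let (m, S) = fold (sequential_step pol d B) (sort_key d [1..<n + 1]) (1, \<lambda>_. {})
      in (m, S, \<lambda>j. pol d (S j)))"

definition sequential_bins :: "policy \<Rightarrow> nat \<Rightarrow> (nat \<Rightarrow> nat) \<Rightarrow> real \<Rightarrow> nat" where
  "sequential_bins pol n d B = fst (sequential_algorithm pol n d B)"

end

theory Submission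
  imports Defs "HOL-Library.Log_Nat"
begin

text \<open>
  Put the items into levels \<open>0, \<dots>, k - 1\<close>, where level \<open>l\<close> consists of the \<open>R ^ l * (R - 1)\<close>
  numbers \<open>i\<close> with \<open>R ^ l \<le> i < R ^ (l + 1)\<close>, all of them due \<open>R ^ (k - l)\<close> time units before a
  common time \<open>\<mu>\<close>. Delivering everything at \<open>\<mu>\<close> costs \<open>(R - 1) * R ^ k\<close> per level, so a single
  bin suffices for \<open>B = k * (R - 1) * R ^ k\<close>. Under early delivery, however, a bin that contains
  an item of level \<open>l\<close> together with all of level \<open>l + 1\<close> costs at least \<open>(R - 1)\<^sup>2 * R ^ k\<close>,
  which exceeds \<open>B\<close> for \<open>R = k + 2\<close>. Hence every new bin advances the level by at most one, and
  the sequential algorithm uses at least \<open>k\<close> bins.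
\<close>

text \<open>Loop invariant for items arriving in numerical order. The potential \<open>f\<close>
  plays the role of the level: \<open>step\<close> says that a bin within budget raises it by at
  most one, so the open bin \<open>j\<close> starts at a potential of at most
  \<open>f 1 + (j - 1)\<close>.\<close>

lemma sequential_fold_bin:
  fixes f :: "nat \<Rightarrow> nat"
  assumes single: "\<And>i. inventory_cost d {i} (pol d {i}) \<le> B"
    and step: "\<And>a b. 1 \<le> a \<Longrightarrow> a \<le> b \<Longrightarrow> b \<le> n \<Longrightarrow>
      inventory_cost d {a..b} (pol d {a..b}) \<le> B \<Longrightarrow> f (b + 1) \<le> f a + 1"
    and "1 \<le> i" "i \<le> n"
    and "fold (sequential_step pol d B) [1..<i + 1] (1, \<lambda>_. {}) = (j, S)"
  shows "(\<exists>a\<in>{1..i}. S j = {a..i} \<and> inventory_cost d {a..i} (pol d {a..i}) \<le> B \<and> f a + 1 \<le> f 1 + j)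
    \<and> (\<forall>j'>j. S j' = {})"
  using assms(3-)
proof (induction i arbitrary: j S rule: nat_induct_at_least)
  case base
  then show ?case
    using single[of 1] by (auto simp: sequential_step_def Let_def split: if_splits)
next
  case (Suc i)
  obtain j0 S0 where fold0: "fold (sequential_step pol d B) [1..<i + 1] (1, \<lambda>_. {}) = (j0, S0)"
    by fastforce
  have "i \<le> n"
    using Suc.prems by simp
  from Suc.IH[OF this fold0] obtain a where a: "a \<in> {1..i}" "S0 j0 = {a..i}"
      "inventory_cost d {a..i} (pol d {a..i}) \<le> B" "f a + 1 \<le> f 1 + j0"
    and empty: "\<forall>j'>j0. S0 j' = {}"
    by blast
  have ins: "insert (Suc i) {a..i} = {a..Suc i}"
    using a by auto
  \<comment> \<open>The bin held before the step is within budget, so \<open>step\<close> already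
    bounds the potential of the next item, in case that item has to open a bin.\<close>
  have "f (i + 1) \<le> f a + 1"
    using a \<open>i \<le> n\<close> by (intro step) auto
  then have advance: "f (Suc i) + 1 \<le> f 1 + (j0 + 1)"
    using a by simp
  have "(j, S) = sequential_step pol d B (Suc i) (j0, S0)"
    using Suc.prems fold0 by simp
  then show ?case
  proof (cases "inventory_cost d {a..Suc i} (pol d {a..Suc i}) > B")
    \<comment> \<open>The new bin is exactly \<open>{Suc i}\<close> because the invariant keeps all
      unopened bins empty.\<close>
    case True
    with \<open>(j, S) = _\<close> have "j = j0 + 1" "S = S0(j := {Suc i})"
      using a empty by (auto simp: sequential_step_def Let_def ins)
    then show ?thesis
      using single[of "Suc i"] advance empty by (auto intro!: bexI[of _ "Suc i"])
  next
    case False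
    with \<open>(j, S) = _\<close> have "j = j0" "S = S0(j := {a..Suc i})"
      using a by (auto simp: sequential_step_def Let_def ins)
    then show ?thesis
      using False a empty by (auto intro!: bexI[of _ a])
  qed
qed

lemma sequential_bins_ge:
  fixes f :: "nat \<Rightarrow> nat"
  assumes "1 \<le> n"
    and mono: "\<And>i i'. 1 \<le> i \<Longrightarrow> i \<le> i' \<Longrightarrow> i' \<le> n \<Longrightarrow> d i \<le> d i'"
    and single: "\<And>i. inventory_cost d {i} (pol d {i}) \<le> B"
    and step: "\<And>a b. 1 \<le> a \<Longrightarrow> a \<le> b \<Longrightarrow> b \<le> n \<Longrightarrow>
      inventory_cost d {a..b} (pol d {a..b}) \<le> B \<Longrightarrow> f (b + 1) \<le> f a + 1"
  shows "f (n + 1) \<le> f 1 + sequential_bins pol n d B"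
proof -
  have "sorted (map d [1..<n + 1])"
    using mono by (auto simp: sorted_iff_nth_mono simp del: upt_Suc)
  then have sort: "sort_key d [1..<n + 1] = [1..<n + 1]"
    by (rule sort_key_id_if_sorted)
  obtain j S where fold: "fold (sequential_step pol d B) [1..<n + 1] (1, \<lambda>_. {}) = (j, S)"
    by fastforce
  obtain a where "a \<in> {1..n}" "inventory_cost d {a..n} (pol d {a..n}) \<le> B" "f a + 1 \<le> f 1 + j"
    using sequential_fold_bin[where f = f, OF single step \<open>1 \<le> n\<close> order_refl fold] by blast
  \<comment> \<open>The last bin needs \<open>step\<close> once more; \<open>n + 1\<close> is no
    item and only marks where this bin ends.\<close>
  moreover have "f (n + 1) \<le> f a + 1"
    using calculation by (intro step) auto
  moreover have "sequential_bins pol n d B = j"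
    unfolding sequential_bins_def sequential_algorithm_def sort fold by simp
  ultimately show ?thesis by simp
qed

lemma optimal_solution_single_bin:
  assumes "1 \<le> n" "\<tau> \<ge> 0" "inventory_cost d {1..n} \<tau> \<le> B"
  shows "optimal_solution n d B 1 (\<lambda>_. {1..n}) (\<lambda>_. \<tau>)"
proof -
  have "1 \<le> m" if "feasible_solution n d B m S \<mu>" for m S \<mu>
    using that \<open>1 \<le> n\<close> by (cases m) (auto simp: feasible_solution_def partition_on_def)
  moreover have "partition_on {1..n} {{1..n}}"
    using \<open>1 \<le> n\<close> by (auto simp: partition_on_def)
  then have "feasible_solution n d B 1 (\<lambda>_. {1..n}) (\<lambda>_. \<tau>)"
    unfolding feasible_solution_def using assms by simp
  ultimately show ?thesis
    unfolding optimal_solution_def by blast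
qed

text \<open>Links \<open>floorlog\<close>, the number of base-\<open>R\<close> digits, to the
  levels: level \<open>l\<close> has digit count \<open>Suc l\<close>, hence the exponents
  \<open>k + 1 - floorlog R i\<close> for \<open>k - l\<close>.\<close>

lemma floorlog_eq_Suc:
  assumes "R > 1" "R ^ l \<le> i" "i < R ^ Suc l"
  shows "floorlog R i = Suc l"
  using assms by (intro antisym floorlog_leI floorlog_ge_SucI) auto

text \<open>Every level contributes the same amount, since \<open>(R - 1) * R ^ l\<close> items at
  distance \<open>R ^ (k - l)\<close> cost \<open>(R - 1) * R ^ k\<close>. The separate bound
  \<open>m\<close> lets the induction add levels while \<open>k\<close> stays fixed.\<close>

lemma sum_power_diff_floorlog:
  fixes R k m :: nat
  assumes "R > 1" "m \<le> k"
  shows "(\<Sum>i\<in>{1..<R ^ m}. R ^ (k + 1 - floorlog R i)) = m * (R - 1) * R ^ k"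
  using \<open>m \<le> k\<close>
proof (induction m)
  case 0
  then show ?case by simp
next
  case (Suc m)
  have "(\<Sum>i\<in>{R ^ m..<R ^ Suc m}. R ^ (k + 1 - floorlog R i))
      = (\<Sum>i\<in>{R ^ m..<R ^ Suc m}. R ^ (k - m))"
    using \<open>R > 1\<close> by (intro sum.cong) (auto simp: floorlog_eq_Suc)
  also have "\<dots> = (R - 1) * (R ^ m * R ^ (k - m))"
    by (simp add: algebra_simps diff_mult_distrib)
  also have "R ^ m * R ^ (k - m) = R ^ k"
    using Suc.prems by (simp flip: power_add)
  finally have level: "(\<Sum>i\<in>{R ^ m..<R ^ Suc m}. R ^ (k + 1 - floorlog R i)) = (R - 1) * R ^ k" .
  have "{1..<R ^ Suc m} = {1..<R ^ m} \<union> {R ^ m..<R ^ Suc m}"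
    using \<open>R > 1\<close> by (intro ivl_disj_un_two(3)[symmetric]) auto
  moreover have "{1..<R ^ m} \<inter> {R ^ m..<R ^ Suc m} = {}"
    by auto
  ultimately show ?case
    using Suc level by (simp add: sum.union_disjoint algebra_simps del: power_Suc)
qed

text \<open>The common delivery time is \<open>R ^ k + 1\<close>; the extra 1 keeps level 0 at the
  positive due time 1.\<close>

definition level_due :: "nat \<Rightarrow> nat \<Rightarrow> nat \<Rightarrow> nat" where
  "level_due R k i = R ^ k + 1 - R ^ (k + 1 - floorlog R i)"

lemma power_diff_floorlog_le:
  assumes "R > 1" "1 \<le> i"
  shows "R ^ (k + 1 - floorlog R i) \<le> R ^ k"
proof -
  have "1 \<le> floorlog R i"
    using assms by (intro floorlog_geI) auto
  then show ?thesis
    using assms by (intro power_increasing) auto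
qed

lemma level_due_eq:
  assumes "R > 1" "1 \<le> i"
  shows "level_due R k i + R ^ (k + 1 - floorlog R i) = R ^ k + 1"
  using power_diff_floorlog_le[OF assms, of k] by (simp add: level_due_def)

lemma level_due_pos:
  assumes "R > 1" "1 \<le> i"
  shows "level_due R k i > 0"
  using power_diff_floorlog_le[OF assms, of k] by (simp add: level_due_def)

lemma level_due_mono:
  assumes "R > 1" "i \<le> i'"
  shows "level_due R k i \<le> level_due R k i'"
  unfolding level_due_def
  using assms by (intro diff_le_mono2 power_increasing floorlog_mono) auto

lemma early_delivery_atLeastAtMost:
  assumes "a \<le> b" "\<And>i. a \<le> i \<Longrightarrow> i \<le> b \<Longrightarrow> d a \<le> d i"
  shows "early_delivery d {a..b} = real (d a)"
proof -
  have "Min (d ` {a..b}) = d a"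
    using assms by (intro Min_eqI) auto
  then show ?thesis by (simp add: early_delivery_def)
qed

text \<open>If \<open>b + 1\<close> lies at least two levels above \<open>a\<close>, the bin
  contains the whole level after that of \<open>a\<close>. Delivery happens at the due time of
  \<open>a\<close>, so each item of this level waits for the gap between the two levels.\<close>

lemma level_due_early_cost:
  assumes "R > 1" "1 \<le> a" "b < R ^ k" and jump: "floorlog R a + 1 < floorlog R (b + 1)"
  shows "inventory_cost (level_due R k) {a..b} (early_delivery (level_due R k) {a..b})
    \<ge> real ((R - 1)\<^sup>2 * R ^ k)"
proof -
  let ?d = "level_due R k"
  have "1 \<le> floorlog R a"
    using assms by (intro floorlog_geI) auto
  then obtain l where l: "floorlog R a = Suc l"
    by (cases "floorlog R a") auto
  have a: "a < R ^ Suc l"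
    using floorlog_bounds[of a R] assms l by auto
  have "R ^ (l + 2) \<le> R ^ (floorlog R (b + 1) - 1)"
    using jump l \<open>R > 1\<close> by (intro power_increasing) auto
  also have "\<dots> \<le> b + 1"
    using floorlog_bounds[of "b + 1" R] \<open>R > 1\<close> by auto
  finally have b: "R ^ (l + 2) \<le> b + 1" .
  also have "b + 1 \<le> R ^ k"
    using \<open>b < R ^ k\<close> by simp
  \<comment> \<open>This rules out truncated subtraction in the exponents \<open>k - l\<close> and
    \<open>k - l - 1\<close> below.\<close>
  finally have "l + 2 \<le> k"
    using \<open>R > 1\<close> by (rule power_le_imp_le_exp[rotated])
  have sub: "{R ^ Suc l..<R ^ Suc (Suc l)} \<subseteq> {a..b}"
    using a b by auto
  have "R ^ Suc l < R ^ Suc (Suc l)"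
    using \<open>R > 1\<close> by (intro power_strict_increasing) auto
  then have "R ^ Suc l \<in> {a..b}"
    by (intro subsetD[OF sub]) simp
  then have "a \<le> b" by simp
  have early: "early_delivery ?d {a..b} = real (?d a)"
    using \<open>a \<le> b\<close> \<open>R > 1\<close> by (intro early_delivery_atLeastAtMost level_due_mono) auto
  \<comment> \<open>Level \<open>l + 1\<close> is due \<open>g\<close> before the common time and
    level \<open>l\<close>, that of \<open>a\<close>, is due \<open>R * g\<close> before it; the gap
    is \<open>(R - 1) * g\<close>.\<close>
  define g where "g = R ^ (k - l - 1)"
  have g: "R ^ (k - l) = R * g"
    using \<open>l + 2 \<le> k\<close> unfolding g_def by (simp flip: power_Suc add: Suc_diff_Suc)
  have gap: "real (?d i) - real (?d a) = real ((R - 1) * g)" if "i \<in> {R ^ Suc l..<R ^ Suc (Suc l)}" for i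
  proof -
    have "floorlog R i = Suc (Suc l)"
      using that \<open>R > 1\<close> by (intro floorlog_eq_Suc) auto
    moreover have "1 \<le> i"
      using subsetD[OF sub that] \<open>1 \<le> a\<close> by simp
    ultimately have "?d i + g = ?d a + R * g"
      using level_due_eq[of R i k] level_due_eq[of R a k] assms l g by (simp add: g_def)
    then have "real (?d i) + real g = real (?d a) + real R * real g"
      by (metis of_nat_add of_nat_mult)
    then show ?thesis
      using \<open>R > 1\<close> by (simp add: algebra_simps)
  qed
  have "R ^ Suc (Suc l) - R ^ Suc l = (R - 1) * R ^ Suc l"
    by (simp add: diff_mult_distrib)
  moreover have "R ^ Suc l * g = R ^ k"
    using \<open>l + 2 \<le> k\<close> unfolding g_def by (simp flip: power_add power_Suc)
  ultimately have "(R ^ Suc (Suc l) - R ^ Suc l) * ((R - 1) * g) = (R - 1)\<^sup>2 * R ^ k"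
    by (metis (no_types, opaque_lifting) mult.assoc mult.left_commute power2_eq_square)
  then have "real ((R - 1)\<^sup>2 * R ^ k) = (\<Sum>i\<in>{R ^ Suc l..<R ^ Suc (Suc l)}. real ((R - 1) * g))"
    by (metis card_atLeastLessThan of_nat_mult sum_constant)
  also have "\<dots> = (\<Sum>i\<in>{R ^ Suc l..<R ^ Suc (Suc l)}. \<bar>real (?d i) - real (?d a)\<bar>)"
    using gap by (intro sum.cong) auto
  also have "\<dots> \<le> (\<Sum>i\<in>{a..b}. \<bar>real (?d i) - real (?d a)\<bar>)"
    using sub by (intro sum_mono2) auto
  finally show ?thesis
    by (simp add: inventory_cost_def early)
qed

theorem theorem3:
  shows "\<forall>c::real. \<exists>n d B m S \<mu>.
    cds_instance n d B \<and>
    optimal_solution n d B m S \<mu> \<and>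
    real (sequential_bins early_delivery n d B) > c * real m"
proof
  fix c :: real
  obtain k0 :: nat where "c < real k0"
    using reals_Archimedean2 by blast
  \<comment> \<open>The successor ensures \<open>k \<ge> 1\<close>, so that there is at least one
    item.\<close>
  define k where "k = Suc k0"
  \<comment> \<open>The least \<open>R\<close> with \<open>k < R - 1\<close>, which is what puts
    \<open>B\<close> below the cost \<open>(R - 1)\<^sup>2 * R ^ k\<close> of a bin that skips a
    level.\<close>
  define R where "R = k + 2"
  define n where "n = R ^ k - 1"
  define d where "d = level_due R k"
  define B where "B = real (k * (R - 1) * R ^ k)"
  have "R > 1" "k \<ge> 1" "c < real k"
    using \<open>c < real k0\<close> by (auto simp: R_def k_def)
  have "R ^ 1 \<le> R ^ k"
    using \<open>R > 1\<close> \<open>k \<ge> 1\<close> by (intro power_increasing) auto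
  then have "1 \<le> n" and Suc_n: "n + 1 = R ^ k"
    using \<open>R > 1\<close> by (auto simp: n_def)
  have "B > 0"
    using \<open>R > 1\<close> \<open>k \<ge> 1\<close> by (simp add: B_def)
  have inst: "cds_instance n d B"
    using \<open>1 \<le> n\<close> \<open>B > 0\<close> \<open>R > 1\<close> by (auto simp: cds_instance_def d_def intro!: level_due_pos)

  have "inventory_cost d {1..n} (real (R ^ k + 1)) = (\<Sum>i\<in>{1..n}. real (R ^ (k + 1 - floorlog R i)))"
    unfolding inventory_cost_def
  proof (rule sum.cong)
    fix i assume "i \<in> {1..n}"
    then have "d i + R ^ (k + 1 - floorlog R i) = R ^ k + 1"
      unfolding d_def using \<open>R > 1\<close> by (intro level_due_eq) auto
    then show "\<bar>real (d i) - real (R ^ k + 1)\<bar> = real (R ^ (k + 1 - floorlog R i))"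
      by (metis abs_minus_commute abs_of_nat add_diff_cancel_left' of_nat_add)
  qed simp
  also have "\<dots> = (\<Sum>i\<in>{1..<R ^ k}. real (R ^ (k + 1 - floorlog R i)))"
    using Suc_n by (intro sum.cong) auto
  also have "\<dots> = B"
    unfolding B_def using sum_power_diff_floorlog[OF \<open>R > 1\<close> order_refl] by (metis of_nat_sum)
  finally have "inventory_cost d {1..n} (real (R ^ k + 1)) = B" .
  then have opt: "optimal_solution n d B 1 (\<lambda>_. {1..n}) (\<lambda>_. real (R ^ k + 1))"
    using \<open>1 \<le> n\<close> by (intro optimal_solution_single_bin) auto

  \<comment> \<open>Here \<open>R - 1 = k + 1\<close>.\<close>
  have "k * (R - 1) < (R - 1)\<^sup>2"
    by (simp add: R_def power2_eq_square)
  then have "B < real ((R - 1)\<^sup>2 * R ^ k)"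
    unfolding B_def of_nat_less_iff using \<open>R > 1\<close> by simp
  have "floorlog R (n + 1) \<le> floorlog R 1 + sequential_bins early_delivery n d B"
  proof (rule sequential_bins_ge[OF \<open>1 \<le> n\<close>])
    show "d i \<le> d i'" if "i \<le> i'" for i i'
      unfolding d_def using \<open>R > 1\<close> that by (rule level_due_mono)
    show "inventory_cost d {i} (early_delivery d {i}) \<le> B" for i
      using \<open>B > 0\<close> by (simp add: inventory_cost_def early_delivery_def)
    show "floorlog R (b + 1) \<le> floorlog R a + 1"
      if "1 \<le> a" "b \<le> n" "inventory_cost d {a..b} (early_delivery d {a..b}) \<le> B" for a b
    proof (rule ccontr)
      assume "\<not> floorlog R (b + 1) \<le> floorlog R a + 1"
      moreover have "b < R ^ k"
        using \<open>b \<le> n\<close> Suc_n by simp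
      ultimately have "real ((R - 1)\<^sup>2 * R ^ k) \<le> inventory_cost d {a..b} (early_delivery d {a..b})"
        unfolding d_def using \<open>R > 1\<close> \<open>1 \<le> a\<close> by (intro level_due_early_cost) auto
      with that \<open>B < _\<close> show False by linarith
    qed
  qed
  \<comment> \<open>The end marker \<open>n + 1 = R ^ k\<close> would open level \<open>k\<close>,
    while item 1 has level 0; the difference gives at least \<open>k\<close> bins.\<close>
  moreover have "floorlog R (n + 1) = Suc k" "floorlog R 1 = Suc 0"
    unfolding Suc_n using \<open>R > 1\<close> by (auto intro!: floorlog_eq_Suc)
  ultimately have "c * real (1::nat) < real (sequential_bins early_delivery n d B)"
    using \<open>c < real k\<close> by simp
  with inst opt show "\<exists>n d B m S \<mu>. cds_instance n d B \<and> optimal_solution n d B m S \<mu> \<and>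
      c * real m < real (sequential_bins early_delivery n d B)"
    by blast
qed

end
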